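(* Let $f\colon 2^N\to\mathbb{R}_{\ge0}$ be a non-negative submodular function on a ground set $N$ with $|N|=n$, and let $k\le n$. For any $\varepsilon>0$ there exists a set $G\subseteq N$ with $|G| = O(k/\varepsilon)$ such that for every $k'\le k$, \[ \max_{T\subseteq G,\,|T|\le k'} f(T) \ge \left(\tfrac12-\varepsilon\right)\mathrm{OPT}_{k'}, \] where $\mathrm{OPT}_{k'}=\max_{S\subseteq N,\,|S|\le k'} f(S)$. Moreover, $G$ can be constructed using $O(nk/\varepsilon)$ value-oracle queries.
   Context: $f$ is submodular if $f(A\cup\{x\})-f(A)\ge f(B\cup\{x\})-f(B)$ for all $A\subseteq B\subseteq N$ and $x\notin B$. $f$ need not be monotone, and $f(\emptyset)=0$ is not assumed. *)

theory Defs
  imports Complex_Main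
begin

definition submodular_on :: "'a set \<Rightarrow> ('a set \<Rightarrow> real) \<Rightarrow> bool" where
  "submodular_on N f \<longleftrightarrow>
     (\<forall>A B x. A \<subseteq> B \<longrightarrow> B \<subseteq> N \<longrightarrow> x \<in> N \<longrightarrow> x \<notin> B \<longrightarrow>
        f (A \<union> {x}) - f A \<ge> f (B \<union> {x}) - f B)"

definition nonneg_on :: "'a set \<Rightarrow> ('a set \<Rightarrow> real) \<Rightarrow> bool" where
  "nonneg_on N f \<longleftrightarrow> (\<forall>S. S \<subseteq> N \<longrightarrow> 0 \<le> f S)"

definition max_card_le :: "('a set \<Rightarrow> real) \<Rightarrow> 'a set \<Rightarrow> nat \<Rightarrow> real" where
  "max_card_le f M k = Max (f ` {S. S \<subseteq> M \<and> card S \<le> k})"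

text \<open>
  A deterministic adaptive algorithm in the value-oracle model is a decision tree: it either
  stops with an output set, or queries the value of the objective at a set and continues depending
  on the real number returned. The objective is accessible only through such queries.
\<close>

datatype 'a oracle_algorithm =
    Output "'a set"
  | Query "'a set" "real \<Rightarrow> 'a oracle_algorithm"

primrec output_of :: "('a set \<Rightarrow> real) \<Rightarrow> 'a oracle_algorithm \<Rightarrow> 'a set" where
  "output_of f (Output G) = G"
| "output_of f (Query S cont) = output_of f (cont (f S))"

primrec queries_of :: "('a set \<Rightarrow> real) \<Rightarrow> 'a oracle_algorithm \<Rightarrow> 'a set list" where
  "queries_of f (Output G) = []"
| "queries_of f (Query S cont) = S # queries_of f (cont (f S))"

end

theory Submission imports Defs begin

text \<open>
  Run the greedy algorithm \<open>l = \<lfloor>1/\<epsilon>\<rfloor>\<close> times, each time for \<open>k\<close> steps and on the elements not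
  yet picked; a run always adds the best available element, even when its marginal value is
  negative. Let \<open>G\<close> be the set of all picked elements. Given an optimal set \<open>S\<close> for \<open>k'\<close>, put
  \<open>m = |S - G|\<close> and let \<open>A\<^sub>i\<close> be the first \<open>m\<close> picks of run \<open>i\<close>. Every element of \<open>S - G\<close> was
  available at every step, so \<open>f (A\<^sub>i \<union> (S - G)) - f A\<^sub>i \<le> f A\<^sub>i - f {}\<close>, whence by submodularity
  \<open>f (S \<union> A\<^sub>i) \<le> f A\<^sub>i + f ((S \<inter> G) \<union> A\<^sub>i)\<close>. Both sets on the right are contained in \<open>G\<close> and have
  at most \<open>k'\<close> elements. As the \<open>A\<^sub>i\<close> are disjoint and \<open>f\<close> is non-negative, the left-hand sides
  average to at least \<open>(1 - 1/l) f S\<close>.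
\<close>

section \<open>Submodular functions\<close>

lemma submodular_on_union_diff_le:
  assumes sub: "submodular_on N f" and "finite D" and "A \<subseteq> B" "B \<union> D \<subseteq> N" "D \<inter> B = {}"
  shows "f (B \<union> D) - f B \<le> f (A \<union> D) - f A"
  using \<open>finite D\<close> assms(3-)
proof (induction D rule: finite_induct)
  case empty
  then show ?case by simp
next
  case (insert x D)
  have "f ((B \<union> D) \<union> {x}) - f (B \<union> D) \<le> f ((A \<union> D) \<union> {x}) - f (A \<union> D)"
    using sub[unfolded submodular_on_def, rule_format, of "A \<union> D" "B \<union> D" x] insert by auto
  moreover have "f (B \<union> D) - f B \<le> f (A \<union> D) - f A"
    using insert by auto
  ultimately show ?case by simp
qed

text \<open>By submodularity the changes that the disjoint \<open>A i\<close> cause on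
  \<open>S\<close> add up to at least the change caused by their union, and non-negativity limits
  the loss from that union to \<open>f S\<close>. This takes the place of monotonicity.\<close>

lemma sum_union_disjoint_family_ge:
  assumes sub: "submodular_on N f" and nn: "nonneg_on N f" and "finite N" and "finite I"
    and "S \<subseteq> N" "\<And>i. i \<in> I \<Longrightarrow> A i \<subseteq> N"
    and "\<And>i j. i \<in> I \<Longrightarrow> j \<in> I \<Longrightarrow> i \<noteq> j \<Longrightarrow> A i \<inter> A j = {}"
  shows "(real (card I) - 1) * f S \<le> (\<Sum>i\<in>I. f (S \<union> A i))"
proof -
  \<comment> \<open>The value at the union stays on the left so that the induction closes; it is
    discarded only afterwards, by non-negativity.\<close>
  have "(real (card I) - 1) * f S + f (S \<union> \<Union> (A ` I)) \<le> (\<Sum>i\<in>I. f (S \<union> A i))"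
    using \<open>finite I\<close> assms(6-)
  proof (induction I rule: finite_induct)
    case empty
    then show ?case by simp
  next
    case (insert i I)
    let ?U = "\<Union> (A ` I)"
    have IH: "(real (card I) - 1) * f S + f (S \<union> ?U) \<le> (\<Sum>i\<in>I. f (S \<union> A i))"
      using insert.prems by (intro insert.IH) auto
    have "A i \<inter> ?U = {}"
      using insert.prems(2)[of i] insert.hyps by fastforce
    moreover have "?U \<subseteq> N" "A i \<subseteq> N"
      using insert.prems(1) by auto
    ultimately have "f ((S \<union> ?U) \<union> (A i - S)) - f (S \<union> ?U) \<le> f (S \<union> (A i - S)) - f S"
      using \<open>S \<subseteq> N\<close> \<open>finite N\<close>
      by (intro submodular_on_union_diff_le[OF sub]) (auto intro: finite_subset)
    moreover have "(S \<union> ?U) \<union> (A i - S) = S \<union> \<Union> (A ` insert i I)" "S \<union> (A i - S) = S \<union> A i"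
      by auto
    ultimately show ?case
      using IH insert.hyps by (simp add: algebra_simps)
  qed
  moreover have "S \<union> \<Union> (A ` I) \<subseteq> N"
    using assms(5,6) by auto
  then have "0 \<le> f (S \<union> \<Union> (A ` I))"
    using nn by (simp add: nonneg_on_def)
  ultimately show ?thesis by linarith
qed

text \<open>Every element of \<open>D\<close> is charged to one greedy step.\<close>

lemma greedy_picks_gain:
  assumes sub: "submodular_on N f"
    and "finite D" "card D = m" "D \<subseteq> N" "a ` {..<m} \<subseteq> N" "D \<inter> a ` {..<m} = {}"
    and "\<And>j y. j < m \<Longrightarrow> y \<in> D \<Longrightarrow> f (insert y (a ` {..<j})) \<le> f (insert (a j) (a ` {..<j}))"
  shows "f (a ` {..<m} \<union> D) - f (a ` {..<m}) \<le> f (a ` {..<m}) - f {}"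
  using assms(2-)
proof (induction m arbitrary: D)
  case 0
  then show ?case by simp
next
  case (Suc m)
  \<comment> \<open>Any \<open>y\<close> will do: all of \<open>D\<close> competes at every step, so
    the last pick \<open>a m\<close> can pay for any of its elements. The first \<open>m\<close>
    picks pay for \<open>E\<close>.\<close>
  then obtain y E where D: "D = insert y E" "y \<notin> E" "card E = m" "finite E"
    by (metis card_Suc_eq finite_insert)
  let ?A = "a ` {..<m}" and ?B = "a ` {..<Suc m}"
  have B: "?B = insert (a m) ?A"
    by (simp add: lessThan_Suc)
  have "f (?A \<union> E) - f ?A \<le> f ?A - f {}"
    using Suc.prems D by (intro Suc.IH) (auto simp: B)
  moreover have "f (?B \<union> E) - f ?B \<le> f (?A \<union> E) - f ?A"
    using Suc.prems D by (intro submodular_on_union_diff_le[OF sub]) (auto simp: B)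
  moreover have "f ((?B \<union> E) \<union> {y}) - f (?B \<union> E) \<le> f (?A \<union> {y}) - f ?A"
    using Suc.prems D by (intro submodular_on_union_diff_le[OF sub]) (auto simp: B)
  moreover have "f (?A \<union> {y}) \<le> f ?B"
    using Suc.prems(6)[of m y] D by (simp add: B)
  moreover have "(?B \<union> E) \<union> {y} = ?B \<union> D"
    using D by auto
  ultimately show ?case by simp
qed

section \<open>Cardinality-constrained maxima\<close>

lemma max_card_le_ge:
  assumes "finite M" "T \<subseteq> M" "card T \<le> k"
  shows "f T \<le> max_card_le f M k"
  unfolding max_card_le_def using assms by (intro Max_ge) auto

lemma max_card_le_attained:
  assumes "finite M"
  obtains S where "S \<subseteq> M" "card S \<le> k" "max_card_le f M k = f S"
proof -
  have "Max (f ` {S. S \<subseteq> M \<and> card S \<le> k}) \<in> f ` {S. S \<subseteq> M \<and> card S \<le> k}"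
    using assms by (intro Max_in) (auto intro: exI[of _ "{}"])
  then show ?thesis
    using that unfolding max_card_le_def by auto
qed

section \<open>Repeated greedy runs\<close>

text \<open>A single list \<open>p\<close> records the picks of all runs; run \<open>i\<close> occupies the positions
  from \<open>i * k\<close> to \<open>i * k + k - 1\<close>, and \<open>current_run k p t\<close> is what the run containing
  position \<open>t\<close> picked before that position.\<close>

definition current_run :: "nat \<Rightarrow> 'a list \<Rightarrow> nat \<Rightarrow> 'a set" where
  "current_run k p t = (!) p ` {t - t mod k..<t}"

text \<open>Picks are compared only with elements outside the whole list. These include all of
  \<open>S - G\<close>, and the condition survives appending, since the set of competitors
  shrinks.\<close>

definition greedy_seq :: "('a set \<Rightarrow> real) \<Rightarrow> 'a set \<Rightarrow> nat \<Rightarrow> 'a list \<Rightarrow> bool" where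
  "greedy_seq f N k p \<longleftrightarrow> distinct p \<and> set p \<subseteq> N \<and>
     (\<forall>t<length p. \<forall>y\<in>N - set p.
        f (insert y (current_run k p t)) \<le> f (insert (p ! t) (current_run k p t)))"

lemma current_run_append:
  "t \<le> length p \<Longrightarrow> current_run k (p @ q) t = current_run k p t"
  unfolding current_run_def by (intro image_cong) (auto simp: nth_append)

lemma current_run_mult_add:
  assumes "j < k"
  shows "current_run k p (i * k + j) = (\<lambda>j. p ! (i * k + j)) ` {..<j}"
proof -
  have "{i * k..<i * k + j} = (+) (i * k) ` {..<j}"
    by (simp add: lessThan_atLeast0 add.commute)
  with assms show ?thesis
    by (simp add: current_run_def image_image)
qed

lemma greedy_seq_snoc:
  assumes "greedy_seq f N k p" "x \<in> N - set p"
    and "\<And>y. y \<in> N - set p \<Longrightarrow>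
      f (insert y (current_run k p (length p))) \<le> f (insert x (current_run k p (length p)))"
  shows "greedy_seq f N k (p @ [x])"
proof -
  have "f (insert y (current_run k (p @ [x]) t)) \<le> f (insert ((p @ [x]) ! t) (current_run k (p @ [x]) t))"
    if "t < length (p @ [x])" "y \<in> N - set (p @ [x])" for t y
  proof (cases "t = length p")
    case True
    then show ?thesis
      using assms(3)[of y] that by (simp add: current_run_append)
  next
    case False
    then show ?thesis
      using assms(1) that by (simp add: greedy_seq_def current_run_append nth_append)
  qed
  then show ?thesis
    using assms(1,2) unfolding greedy_seq_def by simp
qed

lemma index_less_mult:
  fixes i j k l :: nat
  assumes "i < l" "j < k"
  shows "i * k + j < k * l"
proof -
  have "i * k + j < Suc i * k"
    using assms by simp
  also have "\<dots> \<le> l * k"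
    using assms by (intro mult_le_mono1) simp
  finally show ?thesis by (simp add: mult.commute)
qed

text \<open>The multiplied-out form also admits \<open>l = 0\<close>. The alternative
  \<open>N \<subseteq> set p\<close> covers a ground set exhausted before all runs are complete; the
  optimal set then lies in \<open>set p\<close>.\<close>

lemma greedy_seq_approx:
  assumes "finite N" and nn: "nonneg_on N f" and sub: "submodular_on N f"
    and p: "greedy_seq f N k p" and len: "length p = k * l \<or> N \<subseteq> set p"
    and "k' \<le> k"
  shows "(real l - 1) * max_card_le f N k' \<le> 2 * real l * max_card_le f (set p) k'"
proof -
  let ?G = "set p"
  obtain S where S: "S \<subseteq> N" "card S \<le> k'" and opt: "max_card_le f N k' = f S"
    using max_card_le_attained[OF \<open>finite N\<close>] by metis
  have G: "?G \<subseteq> N"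
    using p by (simp add: greedy_seq_def)
  have "finite S"
    using S \<open>finite N\<close> finite_subset by blast
  have S0: "0 \<le> f S"
    using nn S by (simp add: nonneg_on_def)
  show ?thesis
  proof (cases "S \<subseteq> ?G")
    case True
    then have "f S \<le> max_card_le f ?G k'"
      using S by (intro max_card_le_ge) auto
    then have "real l * f S \<le> real l * max_card_le f ?G k'"
      by (intro mult_left_mono) auto
    moreover have "0 \<le> real l * f S"
      using S0 by simp
    ultimately show ?thesis
      using S0 unfolding opt left_diff_distrib by linarith
  next
    case False
    then have len: "length p = k * l"
      using len S by auto
    define D where "D = S - ?G"
    define m where "m = card D"
    define a where "a i j = p ! (i * k + j)" for i j
    define A where "A i = a i ` {..<m}" for i
    have D: "finite D" "D \<subseteq> N" "D \<inter> ?G = {}"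
      using \<open>finite S\<close> S by (auto simp: D_def)
    have cardS: "card (S \<inter> ?G) + m = card S"
      using card_Int_Diff[OF \<open>finite S\<close>, of ?G] by (simp add: m_def D_def)
    then have "m \<le> k'"
      using S by simp
    \<comment> \<open>As \<open>m \<le> k' \<le> k\<close>, each of the \<open>l\<close> runs has a
      prefix of \<open>m\<close> picks.\<close>
    then have idx: "i * k + j < length p" if "i < l" "j < m" for i j
      unfolding len using that \<open>k' \<le> k\<close> by (intro index_less_mult) auto
    have AG: "A i \<subseteq> ?G" if "i < l" for i
      using idx[OF that] by (auto simp: A_def a_def)
    have cardA: "card (A i) \<le> m" for i
      unfolding A_def using card_image_le[of "{..<m}" "a i"] by simp
    have disj: "A i \<inter> A i' = {}" if i: "i < l" "i' < l" "i \<noteq> i'" for i i'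
    proof -
      have False if j: "j < m" "j' < m" and eq: "a i j = a i' j'" for j j'
      proof -
        \<comment> \<open>\<open>p\<close> is distinct, so equal picks have equal positions, and
          division by \<open>k\<close> recovers the run.\<close>
        have "i * k + j = i' * k + j'"
          using eq p idx i j by (auto simp: a_def greedy_seq_def nth_eq_iff_index_eq)
        moreover have "j < k" "j' < k"
          using j \<open>m \<le> k'\<close> \<open>k' \<le> k\<close> by auto
        moreover from this have "(i * k + j) div k = i" "(i' * k + j') div k = i'"
          by simp_all
        ultimately show False
          using i by simp
      qed
      then show ?thesis by (auto simp: A_def)
    qed
    have "f (S \<union> A i) \<le> 2 * max_card_le f ?G k'" if i: "i < l" for i
    proof -
      have "f (A i \<union> D) - f (A i) \<le> f (A i) - f {}"
        unfolding A_def
      proof (rule greedy_picks_gain[OF sub])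
        fix j y assume j: "j < m" and y: "y \<in> D"
        have "f (insert y (current_run k p (i * k + j)))
            \<le> f (insert (p ! (i * k + j)) (current_run k p (i * k + j)))"
          using p idx[OF i j] y D unfolding greedy_seq_def by blast
        moreover have "current_run k p (i * k + j) = a i ` {..<j}"
          using j \<open>m \<le> k'\<close> \<open>k' \<le> k\<close> by (simp add: current_run_mult_add a_def[abs_def])
        ultimately show "f (insert y (a i ` {..<j})) \<le> f (insert (a i j) (a i ` {..<j}))"
          by (simp add: a_def)
      qed (use D AG[OF i] G in \<open>auto simp: m_def A_def\<close>)
      moreover have "f (((S \<inter> ?G) \<union> A i) \<union> D) - f ((S \<inter> ?G) \<union> A i) \<le> f (A i \<union> D) - f (A i)"
        using D AG[OF i] G by (intro submodular_on_union_diff_le[OF sub]) auto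
      moreover have "((S \<inter> ?G) \<union> A i) \<union> D = S \<union> A i"
        by (auto simp: D_def)
      moreover have "0 \<le> f {}"
        using nn by (simp add: nonneg_on_def)
      moreover have "f (A i) \<le> max_card_le f ?G k'"
        using AG[OF i] cardA[of i] \<open>m \<le> k'\<close> by (intro max_card_le_ge) auto
      moreover have "f ((S \<inter> ?G) \<union> A i) \<le> max_card_le f ?G k'"
      proof (rule max_card_le_ge)
        \<comment> \<open>The at most \<open>m\<close> picks take the place of the \<open>m\<close>
          elements of \<open>D\<close>, so the size does not exceed that of
          \<open>S\<close>.\<close>
        show "card ((S \<inter> ?G) \<union> A i) \<le> k'"
          using card_Un_le[of "S \<inter> ?G" "A i"] cardA[of i] cardS S by linarith
      qed (use AG[OF i] in auto)
      ultimately show ?thesis by simp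
    qed
    then have "(\<Sum>i<l. f (S \<union> A i)) \<le> real (card {..<l}) * (2 * max_card_le f ?G k')"
      by (intro sum_bounded_above) auto
    moreover have "(real (card {..<l}) - 1) * f S \<le> (\<Sum>i<l. f (S \<union> A i))"
      using S AG G disj by (intro sum_union_disjoint_family_ge[OF sub nn \<open>finite N\<close>]) auto
    ultimately show ?thesis
      by (simp add: opt)
  qed
qed

section \<open>The oracle algorithm\<close>

text \<open>Packages a greedy step as a batch of queries whose continuation sees only the answers;
  \<open>f\<close> itself stays out of the algorithm.\<close>

primrec query_all :: "'a set list \<Rightarrow> (real list \<Rightarrow> 'a oracle_algorithm) \<Rightarrow> 'a oracle_algorithm" where
  "query_all [] c = c []"
| "query_all (S # Ss) c = Query S (\<lambda>v. query_all Ss (\<lambda>vs. c (v # vs)))"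

lemma output_of_query_all [simp]:
  "output_of f (query_all Ss c) = output_of f (c (map f Ss))"
  by (induction Ss arbitrary: c) auto

lemma queries_of_query_all [simp]:
  "queries_of f (query_all Ss c) = Ss @ queries_of f (c (map f Ss))"
  by (induction Ss arbitrary: c) auto

definition list_of :: "'a set \<Rightarrow> 'a list" where
  "list_of A = (SOME xs. set xs = A \<and> distinct xs)"

lemma list_of:
  assumes "finite A"
  shows "set (list_of A) = A" "distinct (list_of A)"
  unfolding list_of_def using someI_ex[OF finite_distinct_list[OF assms]] by auto

text \<open>Decides from the answers alone: \<open>map_of (zip xs vs)\<close> matches a candidate
  with the answer at its position.\<close>

definition best_of :: "'a list \<Rightarrow> real list \<Rightarrow> 'a" where
  "best_of xs vs = (SOME x. x \<in> set xs \<and>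
     (\<forall>y\<in>set xs. the (map_of (zip xs vs) y) \<le> the (map_of (zip xs vs) x)))"

lemma best_of_map:
  assumes "xs \<noteq> []"
  shows "best_of xs (map g xs) \<in> set xs"
    and "y \<in> set xs \<Longrightarrow> g y \<le> g (best_of xs (map g xs))"
proof -
  have "Max (g ` set xs) \<in> g ` set xs"
    using assms by (intro Max_in) auto
  then obtain x where "x \<in> set xs" "g x = Max (g ` set xs)"
    by auto
  then have "\<exists>x. x \<in> set xs \<and> (\<forall>y\<in>set xs. g y \<le> g x)"
    by (intro exI[of _ x]) auto
  moreover have "best_of xs (map g xs) = (SOME x. x \<in> set xs \<and> (\<forall>y\<in>set xs. g y \<le> g x))"
    unfolding best_of_def by (intro arg_cong[where f = Eps] ext) (auto simp: map_of_zip_map)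
  ultimately have "best_of xs (map g xs) \<in> set xs \<and> (\<forall>y\<in>set xs. g y \<le> g (best_of xs (map g xs)))"
    by (simp only:) (erule someI_ex)
  then show "best_of xs (map g xs) \<in> set xs"
    and "y \<in> set xs \<Longrightarrow> g y \<le> g (best_of xs (map g xs))"
    by auto
qed

text \<open>The counter is the number of picks left, not of runs: a new run starts by itself when
  \<open>length p\<close> is a multiple of \<open>k\<close>, where \<open>current_run\<close> is
  empty. Values of the enlarged sets rank the marginals, as the base set is common.\<close>

primrec greedy_alg :: "'a set \<Rightarrow> nat \<Rightarrow> nat \<Rightarrow> 'a list \<Rightarrow> 'a oracle_algorithm" where
  "greedy_alg N k 0 p = Output (set p)"
| "greedy_alg N k (Suc n) p =
    (if N \<subseteq> set p then Output (set p)
     else query_all (map (\<lambda>x. insert x (current_run k p (length p))) (list_of (N - set p)))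
       (\<lambda>vs. greedy_alg N k n (p @ [best_of (list_of (N - set p)) vs])))"

text \<open>The final list \<open>q\<close> depends on the answers, hence the existential. A pick
  costs one query per remaining element, so at most \<open>card N\<close>.\<close>

lemma greedy_alg_correct:
  assumes "finite N" "greedy_seq f N k p"
  shows "\<exists>q. greedy_seq f N k q \<and> output_of f (greedy_alg N k n p) = set q \<and>
      length q \<le> length p + n \<and> (length q = length p + n \<or> N \<subseteq> set q) \<and>
      set (queries_of f (greedy_alg N k n p)) \<subseteq> Pow N \<and>
      length (queries_of f (greedy_alg N k n p)) \<le> n * card N"
  using assms(2)
proof (induction n arbitrary: p)
  case 0
  then show ?case by (intro exI[of _ p]) simp
next
  case (Suc n)
  show ?case
  proof (cases "N \<subseteq> set p")
    case True
    with Suc.prems show ?thesis by (intro exI[of _ p]) simp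
  next
    case False
    define R where "R = list_of (N - set p)"
    define B where "B = current_run k p (length p)"
    define x where "x = best_of R (map (\<lambda>x. f (insert x B)) R)"
    have R: "set R = N - set p" "distinct R"
      using list_of[of "N - set p"] \<open>finite N\<close> by (auto simp: R_def)
    then have "R \<noteq> []"
      using False by auto
    note x = best_of_map[OF this, where g = "\<lambda>x. f (insert x B)", folded x_def, unfolded R(1)]
    have alg: "greedy_alg N k (Suc n) p =
        query_all (map (\<lambda>x. insert x B) R) (\<lambda>vs. greedy_alg N k n (p @ [best_of R vs]))"
      using False by (simp add: R_def B_def)
    have out: "output_of f (greedy_alg N k (Suc n) p) = output_of f (greedy_alg N k n (p @ [x]))"
      unfolding alg by (simp add: x_def comp_def)
    have qs: "queries_of f (greedy_alg N k (Suc n) p) =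
        map (\<lambda>x. insert x B) R @ queries_of f (greedy_alg N k n (p @ [x]))"
      unfolding alg by (simp add: x_def comp_def)
    have "greedy_seq f N k (p @ [x])"
      using x unfolding B_def by (intro greedy_seq_snoc Suc.prems) auto
    from Suc.IH[OF this] obtain q where q: "greedy_seq f N k q"
      "output_of f (greedy_alg N k n (p @ [x])) = set q"
      "length q \<le> length (p @ [x]) + n" "length q = length (p @ [x]) + n \<or> N \<subseteq> set q"
      "set (queries_of f (greedy_alg N k n (p @ [x]))) \<subseteq> Pow N"
      "length (queries_of f (greedy_alg N k n (p @ [x]))) \<le> n * card N"
      by blast
    have "B \<subseteq> set p"
      by (auto simp: B_def current_run_def)
    then have "set (map (\<lambda>x. insert x B) R) \<subseteq> Pow N"
      using Suc.prems R(1) by (auto simp: greedy_seq_def)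
    moreover have "length R \<le> card N"
      using R \<open>finite N\<close> by (metis Diff_subset card_mono distinct_card)
    ultimately show ?thesis
      using q unfolding out qs by (intro exI[of _ q]) auto
  qed
qed

section \<open>Choice of the number of runs and assembly of the bounds\<close>

theorem theorem2:
  "\<exists>(C1::real) (C2::real) (alg :: 'a set \<Rightarrow> nat \<Rightarrow> real \<Rightarrow> 'a oracle_algorithm).
     \<forall>(N :: 'a set) (k :: nat) (\<epsilon> :: real) (f :: 'a set \<Rightarrow> real).
       finite N \<longrightarrow> k \<le> card N \<longrightarrow> \<epsilon> > 0 \<longrightarrow> nonneg_on N f \<longrightarrow> submodular_on N f \<longrightarrow>
       (\<exists>G. G \<subseteq> N \<and>
            real (card G) \<le> C1 * (real k / \<epsilon>) \<and>
            (\<forall>k'\<le>k. max_card_le f G k' \<ge> (1/2 - \<epsilon>) * max_card_le f N k') \<and>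
            output_of f (alg N k \<epsilon>) = G \<and>
            set (queries_of f (alg N k \<epsilon>)) \<subseteq> Pow N \<and>
            real (length (queries_of f (alg N k \<epsilon>))) \<le> C2 * (real (card N) * real k / \<epsilon>))"
\<comment> \<open>Both constants are 1: \<open>\<lfloor>1 / \<epsilon>\<rfloor>\<close> runs of
  \<open>k\<close> steps make at most \<open>k / \<epsilon>\<close> picks, each with at most
  \<open>card N\<close> queries.\<close>
proof (intro exI[of _ 1] exI[of _ "\<lambda>N k \<epsilon>. greedy_alg N k (k * nat \<lfloor>1 / \<epsilon>\<rfloor>) []"] allI impI)
  fix N :: "'a set" and k :: nat and \<epsilon> :: real and f :: "'a set \<Rightarrow> real"
  assume "finite N" and "\<epsilon> > 0" and nn: "nonneg_on N f" and sub: "submodular_on N f"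
  define l where "l = nat \<lfloor>1 / \<epsilon>\<rfloor>"
  let ?alg = "greedy_alg N k (k * l) []"
  have "real l = of_int \<lfloor>1 / \<epsilon>\<rfloor>"
    using \<open>\<epsilon> > 0\<close> by (simp add: l_def)
  then have l: "real l \<le> 1 / \<epsilon>" "1 / \<epsilon> < real l + 1"
    by linarith+
  have "greedy_seq f N k []"
    by (simp add: greedy_seq_def)
  from greedy_alg_correct[OF \<open>finite N\<close> this, of "k * l"] obtain q where q: "greedy_seq f N k q"
    "output_of f ?alg = set q" "length q \<le> k * l" "length q = k * l \<or> N \<subseteq> set q"
    "set (queries_of f ?alg) \<subseteq> Pow N" "length (queries_of f ?alg) \<le> k * l * card N"
    by auto
  have qN: "set q \<subseteq> N"
    using q(1) by (simp add: greedy_seq_def)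
  have kl: "real (k * l) \<le> real k / \<epsilon>"
    using mult_left_mono[OF l(1), of "real k"] by simp
  have "real (card (set q)) \<le> real (k * l)"
    using card_length[of q] q(3) unfolding of_nat_le_iff by linarith
  then have card: "real (card (set q)) \<le> 1 * (real k / \<epsilon>)"
    using kl by simp
  have "real (length (queries_of f ?alg)) \<le> real (k * l) * real (card N)"
    using q(6) by (metis of_nat_le_iff of_nat_mult)
  also have "\<dots> \<le> (real k / \<epsilon>) * real (card N)"
    using kl by (intro mult_right_mono) auto
  finally have queries: "real (length (queries_of f ?alg)) \<le> 1 * (real (card N) * real k / \<epsilon>)"
    by (simp add: mult.commute)
  have approx: "(1/2 - \<epsilon>) * max_card_le f N k' \<le> max_card_le f (set q) k'" if "k' \<le> k" for k'
  proof -
    let ?opt = "max_card_le f N k'" and ?val = "max_card_le f (set q) k'"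
    have f0: "0 \<le> f {}"
      using nn by (simp add: nonneg_on_def)
    have opt0: "0 \<le> ?opt"
      using f0 max_card_le_ge[OF \<open>finite N\<close>, of "{}" k' f] by simp
    show ?thesis
    proof (cases "l = 0")
      case True
      \<comment> \<open>Without any run the approximation factor is negative, and the empty set
        already suffices.\<close>
      then have "\<epsilon> > 1"
        using l \<open>\<epsilon> > 0\<close> by (simp add: field_simps)
      then have "(1/2 - \<epsilon>) * ?opt \<le> 0"
        using opt0 by (intro mult_nonpos_nonneg) auto
      also have "0 \<le> ?val"
        using f0 max_card_le_ge[of "set q" "{}" k' f] by simp
      finally show ?thesis .
    next
      case False
      \<comment> \<open>For \<open>l \<ge> 1\<close>,
        \<open>1 / \<epsilon> < l + 1 \<le> 2 * l\<close>. Hence the loss \<open>1 / (2 * l)\<close>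
        in the factor \<open>(l - 1) / (2 * l)\<close> is at most \<open>\<epsilon>\<close>.\<close>
      then have "1 / \<epsilon> \<le> 2 * real l"
        using l by linarith
      then have "1 \<le> 2 * real l * \<epsilon>"
        using \<open>\<epsilon> > 0\<close> by (simp add: field_simps)
      then have "2 * real l * (1/2 - \<epsilon>) \<le> real l - 1"
        by (simp add: algebra_simps)
      then have "2 * real l * (1/2 - \<epsilon>) * ?opt \<le> (real l - 1) * ?opt"
        using opt0 by (rule mult_right_mono)
      also have "\<dots> \<le> 2 * real l * ?val"
        using greedy_seq_approx[OF \<open>finite N\<close> nn sub q(1,4) that] .
      finally have "2 * real l * ((1/2 - \<epsilon>) * ?opt) \<le> 2 * real l * ?val"
        by (simp only: mult.assoc)
      then show ?thesis
        using False by (subst (asm) mult_le_cancel_left_pos) auto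
    qed
  qed
  show "\<exists>G. G \<subseteq> N \<and>
      real (card G) \<le> 1 * (real k / \<epsilon>) \<and>
      (\<forall>k'\<le>k. max_card_le f G k' \<ge> (1/2 - \<epsilon>) * max_card_le f N k') \<and>
      output_of f (greedy_alg N k (k * nat \<lfloor>1 / \<epsilon>\<rfloor>) []) = G \<and>
      set (queries_of f (greedy_alg N k (k * nat \<lfloor>1 / \<epsilon>\<rfloor>) [])) \<subseteq> Pow N \<and>
      real (length (queries_of f (greedy_alg N k (k * nat \<lfloor>1 / \<epsilon>\<rfloor>) [])))
        \<le> 1 * (real (card N) * real k / \<epsilon>)"
    unfolding l_def[symmetric] using qN card approx q(2,5) queries by blast
qed

end
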